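(* The projective plane $\mathbf{PG}(2,\mathbb{R})$ does not admit Singer groups.
   Context: $\mathbf{PG}(2,\mathbb{R})$ is the projective plane whose points and lines are the $1$- and $2$-dimensional subspaces of $\mathbb{R}^3$; its automorphism group is $\mathbf{P\Gamma L}_3(\mathbb{R})$ (semilinear bijections modulo scalars). A Singer group of a projective plane is a subgroup of its automorphism group that acts sharply transitively on its points (for any two points $x,y$ there is exactly one group element mapping $x$ to $y$). *)

theory Defs
  imports "HOL-Analysis.Analysis" "HOL-Algebra.Coset"
begin

definition PG2_points :: "(real ^ 3) set set" where
  "PG2_points = {P. subspace P \<and> dim P = 1}"

definition PG2_lines :: "(real ^ 3) set set" where
  "PG2_lines = {L. subspace L \<and> dim L = 2}"

definition field_automorphism :: "('a::field \<Rightarrow> 'a) \<Rightarrow> bool" where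
  "field_automorphism \<sigma> \<longleftrightarrow>
     bij \<sigma> \<and> (\<forall>a b. \<sigma> (a + b) = \<sigma> a + \<sigma> b) \<and> (\<forall>a b. \<sigma> (a * b) = \<sigma> a * \<sigma> b)"

definition semilinear :: "(real ^ 3 \<Rightarrow> real ^ 3) \<Rightarrow> bool" where
  "semilinear f \<longleftrightarrow>
     (\<forall>u v. f (u + v) = f u + f v) \<and>
     (\<exists>\<sigma>. field_automorphism \<sigma> \<and> (\<forall>c v. f (c *\<^sub>R v) = \<sigma> c *\<^sub>R f v))"

definition GammaL3 :: "(real ^ 3 \<Rightarrow> real ^ 3) monoid" where
  "GammaL3 = \<lparr>carrier = {f. semilinear f \<and> bij f}, mult = (\<circ>), one = id\<rparr>"

definition scalar_maps :: "(real ^ 3 \<Rightarrow> real ^ 3) set" where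
  "scalar_maps = {f. \<exists>c. c \<noteq> 0 \<and> f = (\<lambda>v. c *\<^sub>R v)}"

definition PGammaL3 :: "(real ^ 3 \<Rightarrow> real ^ 3) set monoid" where
  "PGammaL3 = GammaL3 Mod scalar_maps"

text \<open>The automorphism group of the plane is \<open>PGammaL3\<close>. Its elements are cosets of
  semilinear bijections, composed as maps and hence acting from the left. All members of a coset have the same image on a given subspace, so the
  union below is this common image (\<open>PGammaL3_act_coset\<close>).\<close>

definition PGammaL3_act :: "(real ^ 3 \<Rightarrow> real ^ 3) set \<Rightarrow> (real ^ 3) set \<Rightarrow> (real ^ 3) set" where
  "PGammaL3_act g S = (\<Union>f\<in>g. f ` S)"

definition sharply_transitive_on :: "'g set \<Rightarrow> ('g \<Rightarrow> 'x \<Rightarrow> 'x) \<Rightarrow> 'x set \<Rightarrow> bool" where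
  "sharply_transitive_on G act X \<longleftrightarrow> (\<forall>x\<in>X. \<forall>y\<in>X. \<exists>!g. g \<in> G \<and> act g x = y)"

definition PG2_singer_group :: "(real ^ 3 \<Rightarrow> real ^ 3) set set \<Rightarrow> bool" where
  "PG2_singer_group G \<longleftrightarrow>
     subgroup G PGammaL3 \<and> sharply_transitive_on G PGammaL3_act PG2_points"

lemma field_automorphism_comp:
  "field_automorphism \<sigma> \<Longrightarrow> field_automorphism \<tau> \<Longrightarrow> field_automorphism (\<sigma> \<circ> \<tau>)"
  by (auto simp: field_automorphism_def intro: bij_comp)

lemma field_automorphism_inv:
  assumes "field_automorphism \<sigma>"
  shows "field_automorphism (inv_into UNIV \<sigma>)"
proof -
  have b: "bij \<sigma>" and a: "\<And>x y. \<sigma> (x + y) = \<sigma> x + \<sigma> y" "\<And>x y. \<sigma> (x * y) = \<sigma> x * \<sigma> y"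
    using assms by (auto simp: field_automorphism_def)
  have s: "\<sigma> (inv_into UNIV \<sigma> x) = x" for x using b by (simp add: bij_is_surj surj_f_inv_f)
  have i: "inv_into UNIV \<sigma> (\<sigma> x) = x" for x using b by (simp add: bij_is_inj)
  have "inv_into UNIV \<sigma> (x + y) = inv_into UNIV \<sigma> x + inv_into UNIV \<sigma> y"
    "inv_into UNIV \<sigma> (x * y) = inv_into UNIV \<sigma> x * inv_into UNIV \<sigma> y" for x y
    by (metis a s i)+
  then show ?thesis using b by (auto simp: field_automorphism_def bij_imp_bij_inv)
qed

lemma semilinear_comp:
  assumes "semilinear f" "semilinear g"
  shows "semilinear (f \<circ> g)"
proof -
  obtain \<sigma> where s: "field_automorphism \<sigma>" "\<And>c v. f (c *\<^sub>R v) = \<sigma> c *\<^sub>R f v"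
    using assms(1) unfolding semilinear_def by blast
  obtain \<tau> where t: "field_automorphism \<tau>" "\<And>c v. g (c *\<^sub>R v) = \<tau> c *\<^sub>R g v"
    using assms(2) unfolding semilinear_def by blast
  have "(f \<circ> g) (c *\<^sub>R v) = (\<sigma> \<circ> \<tau>) c *\<^sub>R (f \<circ> g) v" for c v by (simp add: s t)
  moreover have "(f \<circ> g) (u + v) = (f \<circ> g) u + (f \<circ> g) v" for u v
    using assms by (simp add: semilinear_def)
  ultimately show ?thesis
    using field_automorphism_comp[OF s(1) t(1)] unfolding semilinear_def by blast
qed

lemma semilinear_inv:
  assumes "semilinear f" "bij f"
  shows "semilinear (inv_into UNIV f)"
proof -
  obtain \<sigma> where s: "field_automorphism \<sigma>" "\<And>c v. f (c *\<^sub>R v) = \<sigma> c *\<^sub>R f v"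
    using assms(1) unfolding semilinear_def by blast
  have bs: "bij \<sigma>" using s(1) by (simp add: field_automorphism_def)
  have fi: "f (inv_into UNIV f x) = x" "inv_into UNIV f (f x) = x" for x
    using assms(2) by (simp_all add: bij_is_surj surj_f_inv_f bij_is_inj)
  have si: "\<sigma> (inv_into UNIV \<sigma> c) = c" for c using bs by (simp add: bij_is_surj surj_f_inv_f)
  have add: "f (u + v) = f u + f v" for u v using assms(1) by (simp add: semilinear_def)
  have "inv_into UNIV f (u + v) = inv_into UNIV f u + inv_into UNIV f v" for u v by (metis add fi)
  moreover have "inv_into UNIV f (c *\<^sub>R v) = inv_into UNIV \<sigma> c *\<^sub>R inv_into UNIV f v" for c v
    by (metis s(2) si fi)
  ultimately show ?thesis
    using field_automorphism_inv[OF s(1)] unfolding semilinear_def by blast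
qed

lemma semilinear_scale: "semilinear (\<lambda>v. c *\<^sub>R v)"
proof -
  have "field_automorphism (id :: real \<Rightarrow> real)" by (simp add: field_automorphism_def)
  then show ?thesis unfolding semilinear_def
    by (auto simp: scaleR_add_right intro!: exI[of _ "id :: real \<Rightarrow> real"])
qed

lemma bij_scale: "c \<noteq> 0 \<Longrightarrow> bij (\<lambda>v::real^3. c *\<^sub>R v)"
  by (rule o_bij[of "\<lambda>v. inverse c *\<^sub>R v"]) auto

lemma group_GammaL3: "group GammaL3"
proof (rule groupI)
  fix f assume "f \<in> carrier GammaL3"
  then have f: "semilinear f" "bij f" by (auto simp: GammaL3_def)
  then have "inv_into UNIV f \<in> carrier GammaL3" "inv_into UNIV f \<otimes>\<^bsub>GammaL3\<^esub> f = \<one>\<^bsub>GammaL3\<^esub>"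
    by (auto simp: GammaL3_def semilinear_inv bij_imp_bij_inv bij_is_inj)
  then show "\<exists>g\<in>carrier GammaL3. g \<otimes>\<^bsub>GammaL3\<^esub> f = \<one>\<^bsub>GammaL3\<^esub>" by blast
next
  show "\<one>\<^bsub>GammaL3\<^esub> \<in> carrier GammaL3"
    using semilinear_scale[of 1] bij_scale[of 1] by (simp add: GammaL3_def id_def)
qed (auto simp: GammaL3_def semilinear_comp bij_comp o_assoc)

lemma scalar_maps_normal: "scalar_maps \<lhd> GammaL3"
proof -
  interpret group GammaL3 by (rule group_GammaL3)
  have sub: "subgroup scalar_maps GammaL3"
  proof (rule subgroupI)
    show "scalar_maps \<subseteq> carrier GammaL3"
      by (auto simp: scalar_maps_def GammaL3_def semilinear_scale bij_scale)
    show "scalar_maps \<noteq> {}" by (auto simp: scalar_maps_def intro: exI[of _ 1])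
  next
    fix f assume "f \<in> scalar_maps"
    then obtain c where c: "c \<noteq> 0" "f = (\<lambda>v. c *\<^sub>R v)" by (auto simp: scalar_maps_def)
    define g :: "real^3 \<Rightarrow> real^3" where "g = (\<lambda>v. inverse c *\<^sub>R v)"
    have g: "g \<in> scalar_maps" using c by (auto simp: scalar_maps_def g_def intro!: exI[of _ "inverse c"])
    have car: "f \<in> carrier GammaL3" "g \<in> carrier GammaL3"
      using c by (auto simp: g_def GammaL3_def semilinear_scale bij_scale)
    have "g \<otimes>\<^bsub>GammaL3\<^esub> f = \<one>\<^bsub>GammaL3\<^esub>" using c by (auto simp: GammaL3_def g_def)
    then have "inv\<^bsub>GammaL3\<^esub> f = g" using inv_equality car by blast
    then show "inv\<^bsub>GammaL3\<^esub> f \<in> scalar_maps" using g by simp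
  next
    fix f g assume "f \<in> scalar_maps" "g \<in> scalar_maps"
    then obtain c d where "c \<noteq> 0" "f = (\<lambda>v. c *\<^sub>R v)" "d \<noteq> 0" "g = (\<lambda>v. d *\<^sub>R v)"
      by (auto simp: scalar_maps_def)
    then show "f \<otimes>\<^bsub>GammaL3\<^esub> g \<in> scalar_maps"
      by (auto simp: scalar_maps_def GammaL3_def intro!: exI[of _ "c * d"])
  qed
  have "x \<otimes>\<^bsub>GammaL3\<^esub> h \<otimes>\<^bsub>GammaL3\<^esub> inv\<^bsub>GammaL3\<^esub> x \<in> scalar_maps"
    if x: "x \<in> carrier GammaL3" and h: "h \<in> scalar_maps" for x h
  proof -
    obtain c where c: "c \<noteq> 0" "h = (\<lambda>v. c *\<^sub>R v)" using h by (auto simp: scalar_maps_def)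
    obtain \<sigma> where s: "field_automorphism \<sigma>" "\<And>c v. x (c *\<^sub>R v) = \<sigma> c *\<^sub>R x v"
      using x unfolding GammaL3_def semilinear_def by auto
    have "\<sigma> 0 = 0" by (metis s(1) field_automorphism_def add_cancel_right_right)
    then have c': "\<sigma> c \<noteq> 0" using s(1) c(1)
      by (metis field_automorphism_def bij_is_inj injD)
    define k :: "real^3 \<Rightarrow> real^3" where "k = (\<lambda>v. \<sigma> c *\<^sub>R v)"
    have k: "k \<in> scalar_maps" using c' by (auto simp: scalar_maps_def k_def)
    have car: "h \<in> carrier GammaL3" "k \<in> carrier GammaL3"
      using subgroup.mem_carrier[OF sub] h k by simp_all
    have "x \<otimes>\<^bsub>GammaL3\<^esub> h = k \<otimes>\<^bsub>GammaL3\<^esub> x"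
      using s c by (auto simp: GammaL3_def k_def)
    then have "x \<otimes>\<^bsub>GammaL3\<^esub> h \<otimes>\<^bsub>GammaL3\<^esub> inv\<^bsub>GammaL3\<^esub> x = k"
      by (metis x car m_assoc inv_closed r_inv r_one)
    then show ?thesis using k by simp
  qed
  then show ?thesis using sub by (simp add: normal_inv_iff)
qed

lemma group_PGammaL3: "group PGammaL3"
  unfolding PGammaL3_def by (rule normal.factorgroup_is_group[OF scalar_maps_normal])

lemma PGammaL3_act_coset:
  assumes "subspace S" "f \<in> carrier GammaL3"
  shows "PGammaL3_act (scalar_maps #>\<^bsub>GammaL3\<^esub> f) S = f ` S"
proof -
  obtain \<sigma> where s: "field_automorphism \<sigma>" "\<And>c v. f (c *\<^sub>R v) = \<sigma> c *\<^sub>R f v"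
    using assms(2) unfolding GammaL3_def semilinear_def by auto
  have scale: "c *\<^sub>R f v \<in> f ` S" if "v \<in> S" for c v
  proof -
    have "\<sigma> (inv_into UNIV \<sigma> c) = c" using s(1)
      by (simp add: field_automorphism_def bij_is_surj surj_f_inv_f)
    then have "c *\<^sub>R f v = f (inv_into UNIV \<sigma> c *\<^sub>R v)" using s(2) by simp
    then show ?thesis using subspace_scale[OF assms(1) that] by blast
  qed
  have coset: "scalar_maps #>\<^bsub>GammaL3\<^esub> f = {\<lambda>v. c *\<^sub>R f v |c. c \<noteq> 0}"
    by (auto simp: r_coset_def GammaL3_def scalar_maps_def comp_def)
  show ?thesis
  proof
    show "PGammaL3_act (scalar_maps #>\<^bsub>GammaL3\<^esub> f) S \<subseteq> f ` S"
      using scale by (auto simp: PGammaL3_act_def coset)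
    have "(\<lambda>v. 1 *\<^sub>R f v) \<in> scalar_maps #>\<^bsub>GammaL3\<^esub> f"
      unfolding coset by (intro CollectI exI[of _ 1]) simp
    then show "f ` S \<subseteq> PGammaL3_act (scalar_maps #>\<^bsub>GammaL3\<^esub> f) S"
      unfolding PGammaL3_act_def by force
  qed
qed

lemma semilinear_subspace_image:
  assumes "semilinear f" "subspace S"
  shows "subspace (f ` S)" "dim (f ` S) \<le> dim S"
proof -
  obtain \<sigma> where s: "field_automorphism \<sigma>" "\<And>c v. f (c *\<^sub>R v) = \<sigma> c *\<^sub>R f v"
    using assms(1) unfolding semilinear_def by blast
  have add: "f (u + v) = f u + f v" for u v using assms(1) by (simp add: semilinear_def)
  have f0: "f 0 = 0" by (metis add add_cancel_right_right)
  have si: "c = \<sigma> (inv_into UNIV \<sigma> c)" for c using s(1)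
    by (simp add: field_automorphism_def bij_is_surj surj_f_inv_f)
  show "subspace (f ` S)"
  proof (rule subspaceI)
    show "0 \<in> f ` S" using f0 assms(2) subspace_0 by force
    show "x + y \<in> f ` S" if "x \<in> f ` S" "y \<in> f ` S" for x y
      using that assms(2) by (auto simp: add[symmetric] subspace_add)
    show "c *\<^sub>R x \<in> f ` S" if "x \<in> f ` S" for c x
      using that assms(2) by (subst si) (auto simp: s(2)[symmetric] subspace_scale)
  qed
  obtain B where B: "B \<subseteq> S" "independent B" "S \<subseteq> span B" "card B = dim S"
    using basis_exists by metis
  have fin: "finite B" using B(2) independent_bound by blast
  have "subspace {v. f v \<in> span (f ` B)}"
    by (rule subspaceI) (auto simp: f0 add s(2) span_0 span_add span_scale)
  moreover have "B \<subseteq> {v. f v \<in> span (f ` B)}" by (auto intro: span_base)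
  ultimately have "span B \<subseteq> {v. f v \<in> span (f ` B)}" by (rule span_minimal[rotated])
  then have "f ` S \<subseteq> span (f ` B)" using B(3) by auto
  then have "dim (f ` S) \<le> card (f ` B)" using dim_le_card fin by blast
  also have "\<dots> \<le> dim S" using fin B(4) card_image_le by metis
  finally show "dim (f ` S) \<le> dim S" .
qed

lemma GammaL3_image:
  assumes "f \<in> carrier GammaL3" "subspace S"
  shows "subspace (f ` S)" "dim (f ` S) = dim S"
proof -
  have f: "semilinear f" "bij f" using assms(1) by (auto simp: GammaL3_def)
  show sub: "subspace (f ` S)" by (rule semilinear_subspace_image[OF f(1) assms(2)])
  have "inv_into UNIV f ` (f ` S) = S" using f(2) by (simp add: bij_is_inj image_inv_f_f)
  then show "dim (f ` S) = dim S"
    using semilinear_subspace_image(2)[OF f(1) assms(2)]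
      semilinear_subspace_image(2)[OF semilinear_inv[OF f] sub] by simp
qed

lemma PGammaL3_act_points_lines:
  assumes "g \<in> carrier PGammaL3"
  shows "P \<in> PG2_points \<Longrightarrow> PGammaL3_act g P \<in> PG2_points"
    and "L \<in> PG2_lines \<Longrightarrow> PGammaL3_act g L \<in> PG2_lines"
proof -
  obtain f where f: "f \<in> carrier GammaL3" "g = scalar_maps #>\<^bsub>GammaL3\<^esub> f"
    using assms by (auto simp: PGammaL3_def FactGroup_def RCOSETS_def)
  show "P \<in> PG2_points \<Longrightarrow> PGammaL3_act g P \<in> PG2_points"
    and "L \<in> PG2_lines \<Longrightarrow> PGammaL3_act g L \<in> PG2_lines"
    using f by (auto simp: PG2_points_def PG2_lines_def PGammaL3_act_coset GammaL3_image)
qed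

end

theory Submission
  imports Defs
begin

text \<open>
  The proof rests on two properties of the real field. First, \<open>\<real>\<close> has no field automorphism
  other than the identity (\<open>real_field_automorphism_eq_id\<close>): an automorphism maps squares to
  squares, so it preserves the order, and it fixes the dense subfield of rationals. Hence every
  semilinear map of \<open>\<real>\<^sup>3\<close> is linear. Second, polynomials of odd degree have a real root, so a linear
  map of an odd-dimensional real space has an eigenvector (\<open>odd_dim_real_eigenvector\<close>).

  Together they show that every collineation in \<open>P\<Gamma>L\<^sub>3(\<real>)\<close> fixes a point of the plane
  (\<open>PGammaL3_fixes_point\<close>). In a sharply transitive group only the identity has a fixed point, so
  a Singer group would be trivial; but the trivial group is not transitive on a plane with more
  than one point.
\<close>

lemma real_field_automorphism_eq_id:
  fixes \<sigma> :: "real \<Rightarrow> real"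
  assumes "field_automorphism \<sigma>"
  shows "\<sigma> = id"
proof -
  have inj: "inj \<sigma>" and add: "\<And>a b. \<sigma> (a + b) = \<sigma> a + \<sigma> b"
    and mult: "\<And>a b. \<sigma> (a * b) = \<sigma> a * \<sigma> b"
    using assms by (auto simp: field_automorphism_def bij_is_inj)
  interpret additive \<sigma> by standard (rule add)
  have nz: "\<sigma> x \<noteq> 0" if "x \<noteq> 0" for x
    using that injD[OF inj, of x 0] by (auto simp: zero)
  have one: "\<sigma> 1 = 1"
    using mult[of 1 1] nz[of 1] by simp
  have nat: "\<sigma> (of_nat n) = of_nat n" for n
    by (induction n) (simp_all add: zero one add)
  have int: "\<sigma> (of_int k) = of_int k" for k
    by (cases k rule: int_diff_cases) (simp add: diff nat)
  have rat: "\<sigma> q = q" if "q \<in> \<rat>" for q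
  proof -
    obtain a b where q: "b > 0" "q = of_int a / of_int b"
      using \<open>q \<in> \<rat>\<close> by (rule Rats_cases') blast
    then have "\<sigma> q * of_int b = q * of_int b"
      using mult[of q "of_int b"] by (simp add: int)
    then show ?thesis
      using q(1) by simp
  qed
  \<comment> \<open>Positive reals are the nonzero squares.\<close>
  have pos: "\<sigma> x > 0" if "x > 0" for x
    using that mult[of "sqrt x" "sqrt x"] nz[of "sqrt x"]
    by (auto simp: zero_less_mult_iff linorder_neq_iff)
  have less: "\<sigma> x < \<sigma> y" if "x < y" for x y
    using pos[of "y - x"] that by (simp add: diff)
  have "\<sigma> x = x" for x
  proof (rule ccontr)
    assume "\<sigma> x \<noteq> x"
    then consider "\<sigma> x < x" | "x < \<sigma> x" by linarith
    then show False
    proof cases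
      case 1
      then obtain q where "q \<in> \<rat>" "\<sigma> x < q" "q < x" using Rats_dense_in_real by blast
      then show False using less[of q x] rat by simp
    next
      case 2
      then obtain q where "q \<in> \<rat>" "x < q" "q < \<sigma> x" using Rats_dense_in_real by blast
      then show False using less[of x q] rat by simp
    qed
  qed
  then show ?thesis by auto
qed

lemma semilinear_imp_linear:
  assumes "semilinear f"
  shows "linear f"
proof -
  obtain \<sigma> where "field_automorphism \<sigma>" "\<And>c v. f (c *\<^sub>R v) = \<sigma> c *\<^sub>R f v"
    using assms unfolding semilinear_def by blast
  then show ?thesis
    using assms real_field_automorphism_eq_id[of \<sigma>]
    by (intro linearI) (auto simp: semilinear_def)
qed

lemma continuous_on_det:
  fixes M :: "'a::topological_space \<Rightarrow> real ^ 'n ^ 'n"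
  assumes "continuous_on S M"
  shows "continuous_on S (\<lambda>t. det (M t))"
  unfolding det_def by (intro continuous_intros assms)

text \<open>The characteristic polynomial \<open>det (A - t I)\<close> has odd degree, so it changes sign. Its behaviour
  at infinity is read off without its coefficients: substituting \<open>t = 1/s\<close> gives
  \<open>s\<^sup>n det (A - I/s) = det (s A - I)\<close>, which is continuous and equals \<open>(-1)\<^sup>n = -1\<close> at \<open>s = 0\<close>.
  So near \<open>0\<close> it is negative on both sides, while \<open>s\<^sup>n\<close> changes sign there.\<close>

lemma odd_dim_real_eigenvector:
  fixes f :: "real ^ 'n \<Rightarrow> real ^ 'n"
  assumes "linear f" and "odd CARD('n)"
  obtains c v where "v \<noteq> 0" "f v = c *\<^sub>R v"
proof -
  define A where "A = matrix f"
  define p where "p t = det (A - t *\<^sub>R mat 1)" for t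
  define q where "q s = det (s *\<^sub>R A - mat 1)" for s
  have scale: "det (r *\<^sub>R M) = r ^ CARD('n) * det M" for r and M :: "real ^ 'n ^ 'n"
    using det_rows_mul[of "\<lambda>_. r" "\<lambda>i. M $ i"]
    by (simp add: scalar_mult_eq_scaleR scaleR_vec_def)
  have q_p: "q s = s ^ CARD('n) * p (1 / s)" if "s \<noteq> 0" for s
    using that scale[of s "A - (1 / s) *\<^sub>R mat 1"]
    by (simp add: p_def q_def scaleR_diff_right)
  have q0: "q 0 = -1"
    using scale[of "-1" "mat 1"] \<open>odd CARD('n)\<close> by (simp add: q_def)
  have "continuous_on UNIV q" and contp: "continuous_on UNIV p"
    unfolding q_def p_def by (intro continuous_on_det continuous_intros)+
  then have "(q \<longlongrightarrow> q 0) (nhds 0)"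
    by (simp only: continuous_on_eq_continuous_at open_UNIV isCont_def tendsto_at_iff_tendsto_nhds) simp
  then have "eventually (\<lambda>s. q s < 0) (nhds 0)"
    by (rule order_tendstoD(2)) (simp add: q0)
  then obtain d where d: "d > 0" "\<And>s. \<bar>s\<bar> < d \<Longrightarrow> q s < 0"
    by (auto simp: eventually_nhds_metric dist_real_def)
  define s where "s = d / 2"
  have s: "s > 0" "q s < 0" "q (- s) < 0"
    using d by (auto simp: s_def)
  have "p (1 / s) < 0"
    using s q_p[of s] by (simp add: mult_less_0_iff)
  moreover have "p (- (1 / s)) > 0"
    using s q_p[of "- s"] \<open>odd CARD('n)\<close> by (simp add: zero_less_mult_iff)
  ultimately obtain c where "p c = 0"
    using IVT2'[of p "1 / s" 0 "- (1 / s)"] s(1) continuous_on_subset[OF contp] by force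
  then have "\<not> invertible (A - c *\<^sub>R mat 1)"
    by (simp add: p_def invertible_det_nz)
  then obtain v where v: "v \<noteq> 0" "(A - c *\<^sub>R mat 1) *v v = 0"
    by (auto simp: invertible_left_inverse matrix_left_invertible_ker)
  have "f v = A *v v"
    using \<open>linear f\<close> by (simp add: A_def)
  also have "\<dots> = c *\<^sub>R v"
    using v(2) by (simp add: matrix_vector_mult_diff_rdistrib scaleR_matrix_vector_assoc[symmetric])
  finally show thesis
    using v(1) that by blast
qed

lemma span_singleton_PG2_point:
  "v \<noteq> 0 \<Longrightarrow> span {v} \<in> PG2_points"
  by (simp add: PG2_points_def)

lemma PGammaL3_fixes_point:
  assumes "g \<in> carrier PGammaL3"
  obtains P where "P \<in> PG2_points" "PGammaL3_act g P = P"
proof -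
  obtain f where f: "f \<in> carrier GammaL3" and g: "g = scalar_maps #>\<^bsub>GammaL3\<^esub> f"
    using assms by (auto simp: PGammaL3_def FactGroup_def RCOSETS_def)
  have lin: "linear f"
    using f semilinear_imp_linear by (auto simp: GammaL3_def)
  obtain c v where v: "v \<noteq> 0" "f v = c *\<^sub>R v"
    using lin by (rule odd_dim_real_eigenvector) simp
  have "c \<noteq> 0"
  proof
    assume "c = 0"
    then have "f v = f 0" using v linear_0[OF lin] by simp
    moreover have "inj f" using f by (simp add: GammaL3_def bij_is_inj)
    ultimately show False using v(1) by (auto dest: injD)
  qed
  then have "f ` span {v} = span {v}"
    using linear_span_image[OF lin, of "{v}"] span_image_scale[of "{v}" "\<lambda>_. c"] v(2) by simp
  then have "PGammaL3_act g (span {v}) = span {v}"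
    using f by (simp add: g PGammaL3_act_coset)
  then show thesis
    using that span_singleton_PG2_point v(1) by blast
qed

lemma PGammaL3_act_one:
  assumes "subspace S"
  shows "PGammaL3_act \<one>\<^bsub>PGammaL3\<^esub> S = S"
proof -
  interpret group GammaL3 by (rule group_GammaL3)
  have "scalar_maps \<subseteq> carrier GammaL3"
    using scalar_maps_normal by (simp add: normal_imp_subgroup subgroup.subset)
  then have "\<one>\<^bsub>PGammaL3\<^esub> = scalar_maps #>\<^bsub>GammaL3\<^esub> \<one>\<^bsub>GammaL3\<^esub>"
    by (simp add: PGammaL3_def FactGroup_def)
  then show ?thesis
    using PGammaL3_act_coset[OF assms one_closed] by (simp add: GammaL3_def)
qed

lemma PG2_two_points:
  obtains P Q where "P \<in> PG2_points" "Q \<in> PG2_points" "P \<noteq> Q"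
proof
  let ?P = "span {axis 1 1 :: real ^ 3}" and ?Q = "span {axis 2 1 :: real ^ 3}"
  show "?P \<in> PG2_points" "?Q \<in> PG2_points"
    by (simp_all add: span_singleton_PG2_point)
  show "?P \<noteq> ?Q"
  proof
    assume "?P = ?Q"
    then have "axis 1 1 \<in> ?Q" by (metis span_base singletonI)
    then obtain k where "axis 1 1 = k *\<^sub>R (axis 2 1 :: real ^ 3)"
      by (auto simp: span_singleton)
    from arg_cong[OF this, of "\<lambda>w. w $ 1"] show False
      by (simp add: axis_def)
  qed
qed

theorem theorem1p4:
  shows "\<not> (\<exists>G. PG2_singer_group G)"
proof
  assume "\<exists>G. PG2_singer_group G"
  then obtain G where sub: "subgroup G PGammaL3"
    and sharp: "sharply_transitive_on G PGammaL3_act PG2_points"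
    by (auto simp: PG2_singer_group_def)
  have one: "PGammaL3_act \<one>\<^bsub>PGammaL3\<^esub> P = P" if "P \<in> PG2_points" for P
    using that by (simp add: PG2_points_def PGammaL3_act_one)
  have trivial: "g = \<one>\<^bsub>PGammaL3\<^esub>" if "g \<in> G" for g
  proof -
    obtain P where "P \<in> PG2_points" "PGammaL3_act g P = P"
      using PGammaL3_fixes_point subgroup.mem_carrier[OF sub \<open>g \<in> G\<close>] by blast
    then show ?thesis
      using sharp one \<open>g \<in> G\<close> subgroup.one_closed[OF sub]
      unfolding sharply_transitive_on_def by metis
  qed
  obtain P Q where PQ: "P \<in> PG2_points" "Q \<in> PG2_points" "P \<noteq> Q"
    by (rule PG2_two_points)
  then obtain g where "g \<in> G" "PGammaL3_act g P = Q"
    using sharp unfolding sharply_transitive_on_def by blast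
  then show False
    using trivial one PQ by metis
qed

end
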